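(* Let $n\ge 8$ and let $W_n=C_{n-1}\vee K_1$ be the wheel graph with hub $h$ and rim $C_{n-1}$. Let $B\subseteq V(C_{n-1})$ with $|B|\ge 2$. Then $\{h\}\cup B$ is a mutual-visibility set of $W_n$ if and only if $B$ consists of exactly two vertices $u$ and $v$ with $d_{C_{n-1}}(u,v)\le 2$.
   Context: Graphs are finite, simple, undirected and connected. For $X\subseteq V(G)$, two vertices $u,v\in V(G)$ are $X$-visible if there is a shortest $(u,v)$-path $P$ in $G$ with $V(P)\cap X\subseteq\{u,v\}$. A set $X\subseteq V(G)$ is a mutual-visibility set of $G$ if every pair of vertices of $X$ is $X$-visible. The wheel graph $W_n=C_{n-1}\vee K_1$ (join) has $n$ vertices: the hub $h$ (the vertex of $K_1$), adjacent to every vertex of the cycle $C_{n-1}$ (the rim). $d_{C_{n-1}}$ denotes graph distance within the cycle $C_{n-1}$. *)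

theory Defs
  imports "Graph_Theory.Graph_Theory"
begin

(* An undirected edge is a pair of opposite arcs. The distance is infinite between
   vertices of different components. *)
definition graph_dist :: "('a, 'b) pre_digraph \<Rightarrow> 'a \<Rightarrow> 'a \<Rightarrow> ereal" where
  "graph_dist G u v = wf_digraph.\<mu> G (\<lambda>_. 1) u v"

definition shortest_path :: "('a, 'b) pre_digraph \<Rightarrow> 'a \<Rightarrow> 'b awalk \<Rightarrow> 'a \<Rightarrow> bool" where
  "shortest_path G u p v \<longleftrightarrow>
     pre_digraph.apath G u p v \<and> ereal (real (length p)) = graph_dist G u v"

lemma shortest_path_iff_minimal:
  assumes "fin_digraph G"
  shows "shortest_path G u p v \<longleftrightarrow> pre_digraph.apath G u p v \<and>
    (\<forall>q. pre_digraph.apath G u q v \<longrightarrow> length p \<le> length q)"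
proof -
  interpret fin_digraph G by fact
  have awalk_cost_unit: "awalk_cost (\<lambda>_. 1) q = real (length q)" for q
    by (induction q) simp_all
  have le: "graph_dist G u v \<le> ereal (real (length q))" if "apath u q v" for q
    using min_cost_le_walk_cost[OF awalkI_apath[OF that], of "\<lambda>_. 1"]
    by (simp add: graph_dist_def awalk_cost_unit)
  have ex: "\<exists>q. apath u q v \<and> graph_dist G u v = ereal (real (length q))" if "apath u p v"
    using min_cost_awalk[of u v "\<lambda>_. 1"] reachable_awalkI[OF awalkI_apath[OF that]]
    by (simp add: graph_dist_def awalk_cost_unit)
  show ?thesis
  proof
    assume "shortest_path G u p v"
    then show "apath u p v \<and> (\<forall>q. apath u q v \<longrightarrow> length p \<le> length q)"
      using le unfolding shortest_path_def by (metis ereal_less_eq(3) of_nat_le_iff)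
  next
    assume p: "apath u p v \<and> (\<forall>q. apath u q v \<longrightarrow> length p \<le> length q)"
    with ex obtain q where "apath u q v" "graph_dist G u v = ereal (real (length q))" by blast
    with p le[of p] show "shortest_path G u p v"
      by (auto simp: shortest_path_def intro: antisym)
  qed
qed

definition visible :: "('a, 'b) pre_digraph \<Rightarrow> 'a set \<Rightarrow> 'a \<Rightarrow> 'a \<Rightarrow> bool" where
  "visible G X u v \<longleftrightarrow>
     (\<exists>p. shortest_path G u p v \<and> set (pre_digraph.awalk_verts G u p) \<inter> X \<subseteq> {u, v})"

definition mutual_visibility_set :: "('a, 'b) pre_digraph \<Rightarrow> 'a set \<Rightarrow> bool" where
  "mutual_visibility_set G X \<longleftrightarrow>
     X \<subseteq> verts G \<and> (\<forall>u\<in>X. \<forall>v\<in>X. visible G X u v)"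

(* Only for m at least 3 is this the cycle on m vertices. *)
definition cycle_graph :: "nat \<Rightarrow> nat pair_pre_digraph" where
  "cycle_graph m =
     \<lparr> pverts = {..<m},
       parcs = {(i, j). i < m \<and> j < m \<and> (j = Suc i mod m \<or> i = Suc j mod m)} \<rparr>"

definition singleton_graph :: "unit pair_pre_digraph" where
  "singleton_graph = \<lparr> pverts = {()}, parcs = {} \<rparr>"

definition graph_join :: "'a pair_pre_digraph \<Rightarrow> 'b pair_pre_digraph \<Rightarrow> ('a + 'b) pair_pre_digraph" where
  "graph_join G H =
     \<lparr> pverts = pverts G <+> pverts H,
       parcs = {(Inl u, Inl v) | u v. (u, v) \<in> parcs G} \<union> {(Inr x, Inr y) | x y. (x, y) \<in> parcs H}
             \<union> {(Inl u, Inr x) | u x. u \<in> pverts G \<and> x \<in> pverts H}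
             \<union> {(Inr x, Inl u) | u x. u \<in> pverts G \<and> x \<in> pverts H} \<rparr>"

definition wheel_graph :: "nat \<Rightarrow> (nat + unit) pair_pre_digraph" where
  "wheel_graph n = graph_join (cycle_graph (n - 1)) singleton_graph"

definition hub :: "nat + unit" where
  "hub = Inr ()"

lemma pair_graph_cycle_graph:
  assumes "3 \<le> m"
  shows "pair_graph (cycle_graph m)"
proof
  show "finite (parcs (cycle_graph m))"
    by (rule finite_subset[of _ "{..<m} \<times> {..<m}"]) (auto simp: cycle_graph_def)
qed (use assms in \<open>auto simp: cycle_graph_def mod_Suc symmetric_def intro!: symI split: if_splits\<close>)

lemma pair_graph_singleton_graph: "pair_graph singleton_graph"
  by unfold_locales (auto simp: singleton_graph_def symmetric_def intro!: symI)

lemma pair_graph_graph_join: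
  assumes "pair_graph G" "pair_graph H"
  shows "pair_graph (graph_join G H)"
proof -
  interpret G: pair_graph G by fact
  interpret H: pair_graph H by fact
  show ?thesis
  proof
    show fin: "finite (pverts (graph_join G H))"
      by (simp add: graph_join_def)
    show "finite (parcs (graph_join G H))"
      by (rule finite_subset[OF _ finite_cartesian_product[OF fin fin]])
        (auto simp: graph_join_def dest: G.arc_fst_in_verts G.arc_snd_in_verts
           H.arc_fst_in_verts H.arc_snd_in_verts)
  next
    have "sym (parcs G)" "sym (parcs H)"
      using G.pair_sym_arcs H.pair_sym_arcs by (simp_all add: symmetric_def)
    then show "symmetric (graph_join G H)"
      by (auto simp: graph_join_def symmetric_def intro!: symI dest: symD)
  qed (auto simp: graph_join_def dest: G.arc_fst_in_verts G.arc_snd_in_verts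
         H.arc_fst_in_verts H.arc_snd_in_verts G.pair_no_loops H.pair_no_loops)
qed

lemma pair_graph_wheel_graph:
  assumes "4 \<le> n"
  shows "pair_graph (wheel_graph n)"
  unfolding wheel_graph_def
  using assms by (intro pair_graph_graph_join pair_graph_cycle_graph pair_graph_singleton_graph) simp

end

theory Submission
  imports Defs
begin

text \<open>
  Any two vertices of the wheel have distance at most 2, and the hub belongs to the set; hence two
  rim vertices see each other if and only if they are adjacent on the rim or have a common rim
  neighbour outside \<open>B\<close>. In particular they are within distance 2 on the rim. Three vertices of a
  cycle of length at least 7 which are pairwise within distance 2 are consecutive, and then the
  middle one blocks the other two.
\<close>

section \<open>Distances and walks with at most two arcs\<close>

lemma (in fin_digraph) graph_dist_le_iff:
  "graph_dist G u v \<le> ereal (real k) \<longleftrightarrow> (\<exists>p. awalk u p v \<and> length p \<le> k)"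
proof -
  have cost: "awalk_cost (\<lambda>_. 1) p = real (length p)" for p
    by (induction p) simp_all
  show ?thesis
  proof
    assume le: "graph_dist G u v \<le> ereal (real k)"
    \<comment> \<open>An unreachable vertex is at infinite distance, so the finite bound forces
      reachability, and then the minimum is attained by a path.\<close>
    then have "u \<rightarrow>\<^sup>* v"
      by (cases "u \<rightarrow>\<^sup>* v") (auto simp: graph_dist_def shortest_path_inf)
    then obtain p where "apath u p v" "graph_dist G u v = ereal (real (length p))"
      using min_cost_awalk[of u v "\<lambda>_. 1"] by (auto simp: graph_dist_def cost)
    with le show "\<exists>p. awalk u p v \<and> length p \<le> k"
      by (auto intro: awalkI_apath)
  next
    assume "\<exists>p. awalk u p v \<and> length p \<le> k"
    then obtain p where p: "awalk u p v" "length p \<le> k" by blast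
    then show "graph_dist G u v \<le> ereal (real k)"
      using min_cost_le_walk_cost[OF p(1), of "\<lambda>_. 1"]
      by (auto simp: graph_dist_def cost intro: order_trans)
  qed
qed

lemma (in pair_graph) awalk_length_le_2_cases:
  assumes "awalk u p v" "length p \<le> 2" "u \<noteq> v"
  obtains (arc) "p = [(u, v)]" "(u, v) \<in> parcs G"
    | (two) w where "p = [(u, w), (w, v)]" "(u, w) \<in> parcs G" "(w, v) \<in> parcs G"
proof -
  consider "p = []" | e where "p = [e]" | e f where "p = [e, f]"
    using assms(2) by (auto simp: le_Suc_eq length_Suc_conv numeral_2_eq_2)
  then show thesis
    using assms that by cases (auto simp: awalk_simps)
qed

text \<open>Serves both in the wheel, where the hub supplies the bound 2, and in the rim cycle,
  where the bound 2 has to be turned into arcs. An isolated vertex is at distance 0 from itself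
  without any arc, hence \<open>u \<noteq> v\<close>.\<close>

lemma (in pair_graph) graph_dist_le_2_iff:
  assumes "u \<noteq> v"
  shows "graph_dist G u v \<le> 2 \<longleftrightarrow>
    (u, v) \<in> parcs G \<or> (\<exists>w. (u, w) \<in> parcs G \<and> (w, v) \<in> parcs G)"
proof -
  have "graph_dist G u v \<le> 2 \<longleftrightarrow> (\<exists>p. awalk u p v \<and> length p \<le> 2)"
    using graph_dist_le_iff[of u v 2] by simp
  also have "\<dots> \<longleftrightarrow> (u, v) \<in> parcs G \<or> (\<exists>w. (u, w) \<in> parcs G \<and> (w, v) \<in> parcs G)"
    (is "?L \<longleftrightarrow> ?R")
  proof
    assume ?L
    then show ?R using assms by (auto elim!: awalk_length_le_2_cases)
  next
    assume ?R
    then show ?L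
    proof (elim disjE exE conjE)
      assume "(u, v) \<in> parcs G"
      then have "awalk u [(u, v)] v"
        by (auto simp: awalk_simps dest: arc_fst_in_verts arc_snd_in_verts)
      then show ?L by (intro exI[of _ "[(u, v)]"]) simp
    next
      fix w assume "(u, w) \<in> parcs G" "(w, v) \<in> parcs G"
      then have "awalk u [(u, w), (w, v)] v"
        by (auto simp: awalk_simps dest: arc_fst_in_verts arc_snd_in_verts)
      then show ?L by (intro exI[of _ "[(u, w), (w, v)]"]) simp
    qed
  qed
  finally show ?thesis .
qed

section \<open>Visibility between vertices at distance at most two\<close>

lemma (in pair_graph) visible_refl:
  assumes "u \<in> pverts G"
  shows "visible G X u u"
  unfolding visible_def shortest_path_iff_minimal[OF fin_digraph_axioms]
  using assms by (intro exI[of _ "[]"]) (simp add: apath_Nil_iff)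

text \<open>A shortest path here has at most one inner vertex, and only that vertex can be blocked
  by \<open>X\<close>. Adjacent vertices always see each other along their edge.\<close>

lemma (in pair_graph) visible_iff:
  assumes "u \<noteq> v" "graph_dist G u v \<le> 2"
  shows "visible G X u v \<longleftrightarrow>
    (u, v) \<in> parcs G \<or> (\<exists>w. w \<notin> X \<and> (u, w) \<in> parcs G \<and> (w, v) \<in> parcs G)"
proof
  assume "visible G X u v"
  then obtain p where p: "shortest_path G u p v" "set (awalk_verts u p) \<inter> X \<subseteq> {u, v}"
    by (auto simp: visible_def)
  then have "awalk u p v" "ereal (real (length p)) \<le> ereal (real 2)"
    using assms(2) by (auto simp: shortest_path_def intro: awalkI_apath)
  then have "awalk u p v" "length p \<le> 2" by simp_all
  then show "(u, v) \<in> parcs G \<or> (\<exists>w. w \<notin> X \<and> (u, w) \<in> parcs G \<and> (w, v) \<in> parcs G)"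
    using assms(1)
  proof (cases rule: awalk_length_le_2_cases)
    case (two w)
    \<comment> \<open>Without loops \<open>w\<close> is a genuine inner vertex, so it is not among
      the exempted endpoints.\<close>
    then have "w \<noteq> u" "w \<noteq> v" using pair_no_loops[OF two(2)] pair_no_loops[OF two(3)] by simp_all
    with two p(2) show ?thesis by auto
  qed simp
next
  \<comment> \<open>Lower bounds that certify minimality of the explicit paths below: one arc
    always, two arcs if \<open>u\<close> and \<open>v\<close> are not adjacent.\<close>
  have long: "length q \<noteq> 0" "length q = 1 \<Longrightarrow> (u, v) \<in> parcs G" if "apath u q v" for q
    using that assms(1) awalkI_apath[OF that]
    by (auto simp: awalk_simps elim: awalk_length_le_2_cases)
  have "visible G X u v" if uv: "(u, v) \<in> parcs G"
    unfolding visible_def shortest_path_iff_minimal[OF fin_digraph_axioms]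
  proof (intro exI conjI allI impI)
    show "apath u [(u, v)] v"
      using uv assms(1) by (auto simp: apath_simps dest: arc_fst_in_verts arc_snd_in_verts)
    show "length [(u, v)] \<le> length q" if "apath u q v" for q
      using long(1)[OF that] by (cases q) auto
  qed auto
  moreover have "visible G X u v"
    if w: "w \<notin> X" "(u, w) \<in> parcs G" "(w, v) \<in> parcs G" and uv: "(u, v) \<notin> parcs G" for w
    unfolding visible_def shortest_path_iff_minimal[OF fin_digraph_axioms]
  proof (intro exI conjI allI impI)
    have "w \<noteq> u" "w \<noteq> v" using pair_no_loops[OF w(2)] pair_no_loops[OF w(3)] by simp_all
    then show "apath u [(u, w), (w, v)] v"
      using w assms(1) by (auto simp: apath_simps dest: arc_fst_in_verts arc_snd_in_verts)
    show "length [(u, w), (w, v)] \<le> length q" if "apath u q v" for q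
      using long[OF that] uv by (cases "length q") (auto simp: Suc_le_eq)
  qed (use w in auto)
  moreover assume "(u, v) \<in> parcs G \<or> (\<exists>w. w \<notin> X \<and> (u, w) \<in> parcs G \<and> (w, v) \<in> parcs G)"
  ultimately show "visible G X u v" by blast
qed

section \<open>From visibility in the wheel to a condition on the rim\<close>

lemma wheel_graph_simps:
  "Inl i \<in> pverts (wheel_graph n) \<longleftrightarrow> i < n - 1"
  "hub \<in> pverts (wheel_graph n)"
  "(Inl i, Inl j) \<in> parcs (wheel_graph n) \<longleftrightarrow> (i, j) \<in> parcs (cycle_graph (n - 1))"
  "(Inl i, hub) \<in> parcs (wheel_graph n) \<longleftrightarrow> i < n - 1"
  "(hub, Inl i) \<in> parcs (wheel_graph n) \<longleftrightarrow> i < n - 1"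
  by (auto simp: wheel_graph_def graph_join_def singleton_graph_def hub_def cycle_graph_def)

text \<open>The hub is adjacent to every rim vertex, so pairs containing it are visible. It also
  keeps rim vertices within distance 2 of each other, yet it cannot serve as the inner vertex of a
  path between them because it lies in the set.\<close>

lemma mutual_visibility_set_wheel_graph_iff:
  assumes "4 \<le> n" "B \<subseteq> {..<n - 1}"
  shows "mutual_visibility_set (wheel_graph n) ({hub} \<union> Inl ` B) \<longleftrightarrow>
    (\<forall>u\<in>B. \<forall>v\<in>B. u \<noteq> v \<longrightarrow> (u, v) \<in> parcs (cycle_graph (n - 1)) \<or>
      (\<exists>w. w \<notin> B \<and> (u, w) \<in> parcs (cycle_graph (n - 1)) \<and> (w, v) \<in> parcs (cycle_graph (n - 1))))"
    (is "_ \<longleftrightarrow> (\<forall>u\<in>B. \<forall>v\<in>B. u \<noteq> v \<longrightarrow> ?P u v)")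
proof -
  interpret pair_graph "wheel_graph n" using assms(1) by (rule pair_graph_wheel_graph)
  let ?X = "{hub} \<union> Inl ` B"
  have hub_neq: "hub \<noteq> Inl i" "Inl i \<noteq> hub" for i by (simp_all add: hub_def)
  have lt: "u < n - 1" if "u \<in> B" for u using that assms(2) by auto
  have verts: "?X \<subseteq> pverts (wheel_graph n)"
    using lt by (auto simp: wheel_graph_simps)
  have hub_visible: "visible (wheel_graph n) ?X hub (Inl u)" "visible (wheel_graph n) ?X (Inl u) hub"
    if "u \<in> B" for u
  proof -
    have arcs: "(hub, Inl u) \<in> parcs (wheel_graph n)" "(Inl u, hub) \<in> parcs (wheel_graph n)"
      using lt[OF that] by (simp_all add: wheel_graph_simps)
    show "visible (wheel_graph n) ?X hub (Inl u)"
      using arcs hub_neq by (subst visible_iff) (auto simp: graph_dist_le_2_iff simp del: numeral_eq_ereal)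
    show "visible (wheel_graph n) ?X (Inl u) hub"
      using arcs hub_neq by (subst visible_iff) (auto simp: graph_dist_le_2_iff simp del: numeral_eq_ereal)
  qed
  have rim_visible: "visible (wheel_graph n) ?X (Inl u) (Inl v) \<longleftrightarrow> ?P u v"
    if "u \<in> B" "v \<in> B" "u \<noteq> v" for u v
  proof -
    have "graph_dist (wheel_graph n) (Inl u) (Inl v) \<le> 2"
      using that lt by (subst graph_dist_le_2_iff) (auto simp: wheel_graph_simps intro!: exI[of _ hub])
    \<comment> \<open>This is where membership of the hub counts: it is discarded as an intermediate
      vertex, leaving rim vertices outside \<open>B\<close>.\<close>
    moreover have "(\<exists>w. w \<notin> ?X \<and> R w) \<longleftrightarrow> (\<exists>w. w \<notin> B \<and> R (Inl w))" for R
      by (auto simp: hub_def split_sum_ex)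
    ultimately show ?thesis
      using that by (simp add: visible_iff wheel_graph_simps del: Un_iff)
  qed
  have "mutual_visibility_set (wheel_graph n) ?X \<longleftrightarrow>
      (\<forall>u\<in>B. \<forall>v\<in>B. visible (wheel_graph n) ?X (Inl u) (Inl v))"
    using verts hub_visible visible_refl[of hub ?X]
    by (auto simp: mutual_visibility_set_def wheel_graph_simps)
  also have "\<dots> \<longleftrightarrow> (\<forall>u\<in>B. \<forall>v\<in>B. u \<noteq> v \<longrightarrow> ?P u v)"
    using rim_visible visible_refl[of "Inl _" ?X] lt by (auto simp: wheel_graph_simps; metis)
  finally show ?thesis .
qed

section \<open>Short distances on the rim as linear arithmetic\<close>

lemma in_parcs_cycle_graph_iff:
  "(i, j) \<in> parcs (cycle_graph m) \<longleftrightarrow>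
    i < m \<and> j < m \<and> (j = i + 1 \<or> i = j + 1 \<or> i = 0 \<and> j + 1 = m \<or> j = 0 \<and> i + 1 = m)"
proof -
  have succ_mod_iff: "j = Suc i mod m \<longleftrightarrow> j = i + 1 \<or> j = 0 \<and> i + 1 = m" if "i < m" "j < m" for i j
    using that by (cases "Suc i = m") auto
  show ?thesis
  proof (cases "i < m \<and> j < m")
    case True
    then have "(i, j) \<in> parcs (cycle_graph m) \<longleftrightarrow> j = Suc i mod m \<or> i = Suc j mod m"
      by (simp add: cycle_graph_def)
    with True show ?thesis by (simp add: succ_mod_iff) blast
  qed (auto simp: cycle_graph_def)
qed

lemma cycle_graph_two_step_cases:
  assumes "5 \<le> m" "u < v" "v < m"
    and "(u, v) \<in> parcs (cycle_graph m) \<or>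
      (\<exists>w. w \<notin> B \<and> (u, w) \<in> parcs (cycle_graph m) \<and> (w, v) \<in> parcs (cycle_graph m))"
  shows "v = u + 1 \<or> v = u + 2 \<and> u + 1 \<notin> B \<or> v + 1 = u + m \<or> v + 2 = u + m \<and> Suc v mod m \<notin> B"
  using assms(4)
proof (elim disjE exE conjE)
  assume "(u, v) \<in> parcs (cycle_graph m)"
  then show ?thesis using assms(1,2) by (auto simp: in_parcs_cycle_graph_iff)
next
  fix w
  assume "w \<notin> B" and arcs: "(u, w) \<in> parcs (cycle_graph m)" "(w, v) \<in> parcs (cycle_graph m)"
  \<comment> \<open>The two steps go either upwards from \<open>u\<close> to \<open>v\<close>, or
    the other way round across the end of the numbering. In the latter case the middle vertex is the
    cyclic successor of \<open>v\<close>, which is 0 exactly when \<open>v\<close> is the last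
    vertex; hence the case split.\<close>
  have "v = u + 2 \<and> w = u + 1 \<or> v + 2 = u + m \<and> w = Suc v mod m"
  proof (cases "Suc v = m")
    case True
    then show ?thesis
      using arcs assms(1,2) unfolding in_parcs_cycle_graph_iff by (elim conjE disjE) simp_all
  next
    case False
    then have "Suc v mod m = Suc v" using assms(3) by simp
    then show ?thesis
      using arcs assms(1-3) False unfolding in_parcs_cycle_graph_iff
      by (elim conjE disjE) simp_all
  qed
  with \<open>w \<notin> B\<close> show ?thesis by auto
qed

text \<open>The three cyclic gaps add up to \<open>m\<close>, which exceeds 6, so some gap is at
  least 3. Its ends are then close only the other way round, so the remaining two gaps add up to at
  most 2 and both equal 1. The three alternatives record which gap is the long one: from
  \<open>z\<close> round to \<open>x\<close>, from \<open>y\<close> to \<open>z\<close>, or from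
  \<open>x\<close> to \<open>y\<close>.\<close>

lemma three_within_two_cyclic:
  fixes m x y z :: nat
  assumes "7 \<le> m" "x < y" "y < z" "z < m"
    and "y = x + 1 \<or> y = x + 2 \<or> y + 1 = x + m \<or> y + 2 = x + m"
    and "z = y + 1 \<or> z = y + 2 \<or> z + 1 = y + m \<or> z + 2 = y + m"
    and "z = x + 1 \<or> z = x + 2 \<or> z + 1 = x + m \<or> z + 2 = x + m"
  shows "y = x + 1 \<and> z = x + 2 \<or> Suc z = m \<and> x = 0 \<and> (y = 1 \<or> Suc y = z)"
  using assms by (elim disjE) simp_all

theorem lemma1:
  fixes n :: nat and B :: "nat set"
  assumes "n \<ge> 8"
    and "B \<subseteq> verts (cycle_graph (n - 1))"
    and "card B \<ge> 2"
  shows "mutual_visibility_set (wheel_graph n) ({hub} \<union> Inl ` B) \<longleftrightarrow>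
    (\<exists>u v. u \<noteq> v \<and> B = {u, v} \<and> graph_dist (cycle_graph (n - 1)) u v \<le> 2)"
proof -
  define m where "m = n - 1"
  have m: "7 \<le> m" using assms(1) by (simp add: m_def)
  interpret pair_graph "cycle_graph m" using m by (intro pair_graph_cycle_graph) simp
  have B: "B \<subseteq> {..<m}" using assms(2) by (simp add: m_def cycle_graph_def)
  define P where "P u v \<longleftrightarrow> (u, v) \<in> parcs (cycle_graph m) \<or>
      (\<exists>w. w \<notin> B \<and> (u, w) \<in> parcs (cycle_graph m) \<and> (w, v) \<in> parcs (cycle_graph m))" for u v
  have P_sym: "P u v \<longleftrightarrow> P v u" for u v
    by (auto simp: P_def cycle_graph_def)
  have mvs: "mutual_visibility_set (wheel_graph n) ({hub} \<union> Inl ` B) \<longleftrightarrow>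
      (\<forall>u\<in>B. \<forall>v\<in>B. u \<noteq> v \<longrightarrow> P u v)"
    using mutual_visibility_set_wheel_graph_iff[of n B] assms(1) B by (simp add: P_def m_def)
  show ?thesis
    unfolding mvs unfolding m_def[symmetric]
  proof
    assume P: "\<forall>u\<in>B. \<forall>v\<in>B. u \<noteq> v \<longrightarrow> P u v"
    have step: "v = u + 1 \<or> v = u + 2 \<and> u + 1 \<notin> B \<or>
        v + 1 = u + m \<or> v + 2 = u + m \<and> Suc v mod m \<notin> B"
      if "u \<in> B" "v \<in> B" "u < v" for u v
      using cycle_graph_two_step_cases[of m u v B] P that m B by (auto simp: P_def)
    have gap: "v = u + 1 \<or> v = u + 2 \<or> v + 1 = u + m \<or> v + 2 = u + m"
      if "u \<in> B" "v \<in> B" "u < v" for u v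
      using step[OF that] by blast
    \<comment> \<open>In each arrangement \<open>step\<close> is applied to the outer two of three
      consecutive vertices. As \<open>m\<close> is at least 7, it leaves only the route through the
      middle one, which is \<open>y\<close>, \<open>x\<close> or \<open>z\<close> respectively and
      belongs to \<open>B\<close>.\<close>
    have no_three: False if xyz: "x \<in> B" "y \<in> B" "z \<in> B" "x < y" "y < z" for x y z
    proof -
      have "z < m" using xyz B by auto
      have "y = x + 1 \<and> z = x + 2 \<or> Suc z = m \<and> x = 0 \<and> (y = 1 \<or> Suc y = z)"
        using three_within_two_cyclic[OF m xyz(4,5) \<open>z < m\<close>] gap xyz order.strict_trans[OF xyz(4,5)]
        by blast
      then show False
      proof (elim disjE conjE)
        assume "y = x + 1" "z = x + 2"
        then show False using step[of x z] xyz(1-3) m by auto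
      next
        assume "Suc z = m" "x = 0" "y = 1"
        then show False using step[of y z] xyz(1-3) m by auto
      next
        assume "Suc z = m" "x = 0" "Suc y = z"
        then show False using step[of x y] xyz m by auto
      qed
    qed
    have "card B = 2"
    proof (rule ccontr)
      assume "card B \<noteq> 2"
      then have "3 \<le> card B" using assms(3) by simp
      then obtain T where "T \<subseteq> B" "card T = 3" using obtain_subset_with_card_n by metis
      then obtain x y z where "x \<in> B" "y \<in> B" "z \<in> B" "x \<noteq> y" "y \<noteq> z" "x \<noteq> z"
        by (auto simp: card_3_iff)
      \<comment> \<open>Sorting the three vertices puts them in the increasing order that
        \<open>no_three\<close> expects.\<close>
      then show False using no_three by (metis linorder_neqE_nat)
    qed
    then obtain u v where uv: "B = {u, v}" "u \<noteq> v" by (auto simp: card_2_iff)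
    with P have "P u v" by simp
    then have "graph_dist (cycle_graph m) u v \<le> 2"
      using uv by (auto simp: P_def graph_dist_le_2_iff simp del: numeral_eq_ereal)
    with uv show "\<exists>u v. u \<noteq> v \<and> B = {u, v} \<and> graph_dist (cycle_graph m) u v \<le> 2" by blast
  next
    assume "\<exists>u v. u \<noteq> v \<and> B = {u, v} \<and> graph_dist (cycle_graph m) u v \<le> 2"
    then obtain u v where uv: "u \<noteq> v" "B = {u, v}" "graph_dist (cycle_graph m) u v \<le> 2" by blast
    \<comment> \<open>The middle vertex of a walk with two arcs differs from both \<open>u\<close>
      and \<open>v\<close>, since there are no loops, and so it lies outside
      \<open>B = {u, v}\<close>.\<close>
    then have "P u v"
      using pair_no_loops by (auto simp: P_def graph_dist_le_2_iff simp del: numeral_eq_ereal)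
    with uv P_sym show "\<forall>u\<in>B. \<forall>v\<in>B. u \<noteq> v \<longrightarrow> P u v" by auto
  qed
qed

end
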